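(* There is a $1$-PDDS$[Q_3]$ in $\Lambda_3$, where $Q_3=P_2\square P_2\square P_2$ is the $3$-dimensional hypercube.
   Context: $\Lambda_3$ is the infinite graph with vertex set $\mathbb{Z}^3$ in which two vertices are adjacent iff their Euclidean distance is $1$; $d$ denotes graph distance. For $S$ a set of vertices, $[S]$ is the induced subgraph and $d(v,C)=\min\{d(v,w):w\in C\}$. For $t\ge1$, $S$ is a $t$-perfect distance-dominating set ($t$-PDDS) if for each vertex $v$ there is a unique component $C_v$ of $[S]$ with $d(v,C_v)\le t$, and there is in $C_v$ a unique vertex $w$ with $d(v,w)=d(v,C_v)$. A $t$-PDDS$[H]$ is a $t$-PDDS all of whose components are isomorphic to the fixed finite graph $H$. $P_2$ is the path on $2$ vertices and $\square$ is the Cartesian product of graphs. *)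

theory Defs
  imports "HOL-Analysis.Analysis" "Graph_Theory.Graph_Theory"
begin

text \<open>
  Undirected graphs are symmetric digraphs: an edge is a pair of opposite arcs. A
  \<^typ>\<open>'a pair_pre_digraph\<close> is coerced to a \<^typ>\<open>('a, 'a \<times> 'a) pre_digraph\<close>
  by \<^const>\<open>with_proj\<close>. For symmetric digraphs the strongly connected components
  \<^const>\<open>pre_digraph.sccs\<close> are the connected components.
\<close>

definition lattice3 :: "(int ^ 3) pair_pre_digraph" where
  "lattice3 = \<lparr> pverts = UNIV,
     parcs = {(x, y). dist (\<chi> i. real_of_int (x $ i)) (\<chi> i. real_of_int (y $ i)) = 1} \<rparr>"

definition path_graph :: "nat \<Rightarrow> nat pair_pre_digraph" where
  "path_graph n = \<lparr> pverts = {..<n},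
     parcs = {(i, j). i < n \<and> j < n \<and> (j = Suc i \<or> i = Suc j)} \<rparr>"

definition cartesian_product ::
  "'a pair_pre_digraph \<Rightarrow> 'b pair_pre_digraph \<Rightarrow> ('a \<times> 'b) pair_pre_digraph"  (infixr \<open>\<box>\<close> 70)
where
  "G \<box> H = \<lparr> pverts = pverts G \<times> pverts H,
     parcs = {((a, b), (a', b')).
       a = a' \<and> a \<in> pverts G \<and> (b, b') \<in> parcs H \<or>
       (a, a') \<in> parcs G \<and> b = b' \<and> b \<in> pverts H} \<rparr>"

definition hypercube3 :: "(nat \<times> nat \<times> nat) pair_pre_digraph" where
  "hypercube3 = path_graph 2 \<box> path_graph 2 \<box> path_graph 2"

text \<open>
  Graph distance is the least cost of a walk when every arc has cost 1; it is
  \<open>\<infinity>\<close> if there is no walk. The finite values are natural numbers, so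
  the infimum in \<open>graph_dist_set\<close> is a minimum for nonempty \<open>C\<close>. The constant
  \<^const>\<open>wf_digraph.\<mu>\<close> is only specified for well-formed digraphs.
\<close>

definition graph_dist :: "('a, 'b) pre_digraph \<Rightarrow> 'a \<Rightarrow> 'a \<Rightarrow> ereal" where
  "graph_dist G u v = wf_digraph.\<mu> G (\<lambda>_. 1) u v"

definition graph_dist_set :: "('a, 'b) pre_digraph \<Rightarrow> 'a \<Rightarrow> 'a set \<Rightarrow> ereal" where
  "graph_dist_set G v C = (INF w\<in>C. graph_dist G v w)"

text \<open>Distances are measured in \<open>G\<close>, not in the subgraph induced by \<open>S\<close>.\<close>

definition PDDS :: "('a, 'b) pre_digraph \<Rightarrow> nat \<Rightarrow> 'a set \<Rightarrow> bool" where
  "PDDS G t S \<longleftrightarrow> 1 \<le> t \<and> S \<subseteq> verts G \<and>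
     (\<forall>v\<in>verts G.
        (\<exists>!C. C \<in> pre_digraph.sccs (G \<restriction> S) \<and> graph_dist_set G v (verts C) \<le> ereal (real t)) \<and>
        (\<forall>C\<in>pre_digraph.sccs (G \<restriction> S). graph_dist_set G v (verts C) \<le> ereal (real t) \<longrightarrow>
           (\<exists>!w. w \<in> verts C \<and> graph_dist G v w = graph_dist_set G v (verts C))))"

definition PDDS_of ::
  "('a, 'b) pre_digraph \<Rightarrow> nat \<Rightarrow> ('c, 'd) pre_digraph \<Rightarrow> 'a set \<Rightarrow> bool"
where
  "PDDS_of G t H S \<longleftrightarrow> PDDS G t S \<and> (\<forall>C\<in>pre_digraph.sccs (G \<restriction> S). digraph_iso C H)"

lemma lattice3_bidirected: "pair_bidirected_digraph lattice3"
proof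
  show "symmetric (with_proj lattice3)"
    unfolding symmetric_def arcs_ends_conv
    by (rule symI) (auto simp: lattice3_def dist_commute)
qed (auto simp: lattice3_def)

lemma path_graph_pair_graph: "pair_graph (path_graph n)"
proof
  have "parcs (path_graph n) \<subseteq> {..<n} \<times> {..<n}"
    by (auto simp: path_graph_def)
  then show "finite (parcs (path_graph n))"
    by (rule finite_subset) simp
  show "symmetric (with_proj (path_graph n))"
    unfolding symmetric_def arcs_ends_conv
    by (rule symI) (auto simp: path_graph_def)
qed (auto simp: path_graph_def)

lemma cartesian_product_pair_graph:
  assumes "pair_graph G" "pair_graph H"
  shows "pair_graph (G \<box> H)"
proof -
  interpret G: pair_graph G by fact
  interpret H: pair_graph H by fact
  have symG: "(b, a) \<in> parcs G" if "(a, b) \<in> parcs G" for a b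
    using G.arcs_symmetric that by blast
  have symH: "(b, a) \<in> parcs H" if "(a, b) \<in> parcs H" for a b
    using H.arcs_symmetric that by blast
  have sub: "parcs (G \<box> H) \<subseteq> pverts (G \<box> H) \<times> pverts (G \<box> H)"
    by (auto simp: cartesian_product_def dest: G.in_arcsD1 G.in_arcsD2 H.in_arcsD1 H.in_arcsD2)
  have fin: "finite (pverts (G \<box> H))"
    by (simp add: cartesian_product_def)
  show ?thesis
  proof
    show "finite (parcs (G \<box> H))"
      by (rule finite_subset[OF sub]) (simp add: fin)
    show "symmetric (with_proj (G \<box> H))"
      unfolding symmetric_def arcs_ends_conv
      by (rule symI) (auto simp: cartesian_product_def intro: symG symH)
  next
    fix e assume e: "e \<in> parcs (G \<box> H)"
    show "fst e \<in> pverts (G \<box> H)" "snd e \<in> pverts (G \<box> H)"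
      using e sub by auto
    show "fst e \<noteq> snd e"
      using e G.no_loops' H.no_loops' by (auto simp: cartesian_product_def)
  qed (rule fin)
qed

lemma hypercube3_pair_graph: "pair_graph hypercube3"
  unfolding hypercube3_def by (intro cartesian_product_pair_graph path_graph_pair_graph)

end

theory Submission
  imports Defs
begin

text \<open>
  Partition the lattice into the cubes \<open>2b + {0,1}\<^sup>3\<close> and let \<open>S\<close> be the union of
  those cubes whose index \<open>b\<close> has all three coordinates of the same parity. Equivalently, the
  cubes of \<open>S\<close> sit at the points of the body-centred lattice
  \<open>4\<int>\<^sup>3 \<union> (4\<int>\<^sup>3 + (2,2,2))\<close>. Two different cubes of \<open>S\<close> are never adjacent, since one
  step changes at most one coordinate of \<open>b\<close>. A vertex outside \<open>S\<close> lies in a cube where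
  exactly one coordinate of \<open>b\<close> has the wrong parity, so its only neighbour in \<open>S\<close> is
  obtained by leaving that cube in this coordinate direction.
\<close>

section \<open>Perfect domination at distance one\<close>

context wf_digraph begin

section \<open>Small graph distances\<close>

lemma graph_dist_self:
  assumes "u \<in> verts G"
  shows "graph_dist G u u = 0"
proof (rule antisym)
  show "graph_dist G u u \<le> 0"
    using min_cost_le_walk_cost[of u "[]" u "\<lambda>_. 1"] assms
    by (simp add: graph_dist_def awalk_Nil_iff zero_ereal_def)
  show "0 \<le> graph_dist G u u"
    unfolding graph_dist_def \<mu>_def
    by (intro INF_greatest) (auto intro!: pos_cost_pos_awalk_cost)
qed

lemma graph_dist_adj_le:
  assumes "u \<rightarrow> v"
  shows "graph_dist G u v \<le> 1"
proof -
  obtain e where "e \<in> arcs G" "tail G e = u" "head G e = v"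
    using assms by auto
  then have "awalk u [e] v"
    by (auto simp: awalk_Cons_iff awalk_Nil_iff)
  from min_cost_le_walk_cost[OF this, of "\<lambda>_. 1"] show ?thesis
    by (simp add: graph_dist_def one_ereal_def)
qed

lemma graph_dist_neq_ge:
  assumes "u \<noteq> v"
  shows "1 \<le> graph_dist G u v"
  unfolding graph_dist_def \<mu>_def
proof (rule INF_greatest)
  fix p assume "p \<in> {p. awalk u p v}"
  then have "awalk u p v" by simp
  then show "1 \<le> ereal (awalk_cost (\<lambda>_. 1) p)"
    using assms
    by (cases p) (auto simp: awalk_Nil_iff awalk_Cons_iff dest: pos_cost_pos_awalk_cost[of _ _ _ "\<lambda>_. 1"])
qed

text \<open>A walk between such vertices has at least two arcs: the empty walk would force
  \<open>u = v\<close>, a single arc would make them adjacent. Any remaining arcs cost at least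
  0.\<close>

lemma graph_dist_nonadj_ge:
  assumes "u \<noteq> v" "\<not> u \<rightarrow> v"
  shows "2 \<le> graph_dist G u v"
  unfolding graph_dist_def \<mu>_def
proof (rule INF_greatest)
  fix p assume "p \<in> {p. awalk u p v}"
  then have p: "awalk u p v" by simp
  obtain e q where "p = e # q"
    using p assms(1) by (cases p) (auto simp: awalk_Nil_iff)
  moreover obtain e' q' where "q = e' # q'"
    using p assms(2) \<open>p = e # q\<close>
    by (cases q) (auto simp: awalk_Nil_iff awalk_Cons_iff in_arcs_imp_in_arcs_ends)
  ultimately show "2 \<le> ereal (awalk_cost (\<lambda>_. 1) p)"
    using p by (auto simp: awalk_Cons_iff dest: pos_cost_pos_awalk_cost[of _ _ _ "\<lambda>_. 1"])
qed

text \<open>If every vertex of \<open>C\<close> were neither \<open>v\<close> nor a neighbour of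
  \<open>v\<close>, all distances in the infimum would be at least 2. An empty \<open>C\<close> is
  covered as well, its infimum being \<infinity>.\<close>

lemma graph_dist_set_le_1D:
  assumes "graph_dist_set G v C \<le> 1"
  obtains w where "w \<in> C" "w = v \<or> v \<rightarrow> w"
proof (cases "\<exists>w\<in>C. w = v \<or> v \<rightarrow> w")
  case False
  then have "2 \<le> graph_dist_set G v C"
    unfolding graph_dist_set_def by (intro INF_greatest graph_dist_nonadj_ge) auto
  then have "(2::ereal) \<le> 1"
    using assms by (rule order_trans)
  then show ?thesis
    by (simp add: one_ereal_def)
qed (use that in blast)

section \<open>Components of the induced subgraph and a local criterion for perfect
  domination\<close>

text \<open>Both ends of the arc lie in \<open>S\<close>, and by symmetry the arc can be run in
  either direction there, so \<open>v\<close> and \<open>w\<close> are mutually reachable in the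
  induced subgraph.\<close>

lemma sccs_induce_adj_closed:
  assumes sym: "symmetric G" and C: "C \<in> pre_digraph.sccs (G \<restriction> S)"
    and "v \<in> S" "w \<in> verts C" "v \<rightarrow> w"
  shows "v \<in> verts C"
proof -
  interpret GS: wf_digraph "G \<restriction> S"
    by (rule wellformed_induce_subgraph)
  have C': "verts C \<in> GS.sccs_verts"
    using C by (auto simp: GS.sccs_verts_conv)
  then have "w \<in> S"
    using GS.sccs_verts_subsets \<open>w \<in> verts C\<close> by fastforce
  moreover have "w \<rightarrow> v"
    using sym \<open>v \<rightarrow> w\<close> by (auto simp: symmetric_def dest: symD)
  ultimately have "v \<rightarrow>\<^bsub>G \<restriction> S\<^esub> w" "w \<rightarrow>\<^bsub>G \<restriction> S\<^esub> v"
    using \<open>v \<in> S\<close> \<open>v \<rightarrow> w\<close> by (auto simp: arcs_ends_conv)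
  then have "v \<rightarrow>\<^sup>*\<^bsub>G \<restriction> S\<^esub> w" "w \<rightarrow>\<^sup>*\<^bsub>G \<restriction> S\<^esub> v"
    by auto
  then show ?thesis
    using C' \<open>w \<in> verts C\<close> unfolding GS.in_sccs_verts_conv_reachable by blast
qed

text \<open>Each \<open>v\<close> has a strictly nearest vertex \<open>p\<close> of
  \<open>S\<close>: \<open>v\<close> itself if it lies in \<open>S\<close>, its only neighbour in
  \<open>S\<close> otherwise. Every component within distance 1 of \<open>v\<close> must contain
  \<open>p\<close>, so the component of \<open>p\<close> is the only candidate and \<open>p\<close>
  its only closest vertex.\<close>

lemma PDDS_1I:
  assumes sym: "symmetric G" and S: "S \<subseteq> verts G"
    and dom: "\<And>v. v \<in> verts G \<Longrightarrow> v \<notin> S \<Longrightarrow> \<exists>!w. w \<in> S \<and> v \<rightarrow> w"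
  shows "PDDS G 1 S"
proof -
  interpret GS: wf_digraph "G \<restriction> S"
    by (rule wellformed_induce_subgraph)
  have sub: "verts C \<subseteq> S" if "C \<in> GS.sccs" for C
    using that GS.sccs_verts_subsets[of "verts C"] by (auto simp: GS.sccs_verts_conv)
  have "(\<exists>!C. C \<in> GS.sccs \<and> graph_dist_set G v (verts C) \<le> 1) \<and>
      (\<forall>C\<in>GS.sccs. graph_dist_set G v (verts C) \<le> 1 \<longrightarrow>
         (\<exists>!w. w \<in> verts C \<and> graph_dist G v w = graph_dist_set G v (verts C)))"
    if v: "v \<in> verts G" for v
  proof -
    obtain p where p: "p \<in> S" "graph_dist G v p \<le> 1"
      and strict: "\<And>w. w \<in> S \<Longrightarrow> w \<noteq> p \<Longrightarrow> graph_dist G v p < graph_dist G v w"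
      and near: "\<And>C w. C \<in> GS.sccs \<Longrightarrow> w \<in> verts C \<Longrightarrow> w = v \<or> v \<rightarrow> w \<Longrightarrow> p \<in> verts C"
    proof (cases "v \<in> S")
      case True
      show thesis
      proof (rule that[of v])
        show "graph_dist G v v < graph_dist G v w" if "w \<noteq> v" for w
        proof -
          have "(0::ereal) < 1" by simp
          also have "1 \<le> graph_dist G v w"
            using that by (intro graph_dist_neq_ge) auto
          finally show ?thesis
            by (simp add: graph_dist_self v)
        qed
        \<comment> \<open>A component that contains a neighbour of \<open>v \<in> S\<close> also
          contains \<open>v\<close>, so no second component comes within distance 1.\<close>
        show "v \<in> verts C" if "C \<in> GS.sccs" "w \<in> verts C" "w = v \<or> v \<rightarrow> w" for C w
          using that sccs_induce_adj_closed[OF sym that(1) True] by blast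
      qed (simp_all add: True graph_dist_self v)
    next
      case False
      then obtain p where p: "p \<in> S" "v \<rightarrow> p" and uniq: "\<And>w. w \<in> S \<Longrightarrow> v \<rightarrow> w \<Longrightarrow> w = p"
        using dom v by blast
      show thesis
      proof (rule that[of p])
        show "graph_dist G v p < graph_dist G v w" if "w \<in> S" "w \<noteq> p" for w
        proof -
          have "2 \<le> graph_dist G v w"
            using that False uniq by (intro graph_dist_nonadj_ge) auto
          moreover have "(1::ereal) < 2"
            by (simp add: one_ereal_def)
          ultimately show ?thesis
            using graph_dist_adj_le[OF p(2)] by (meson le_less_trans less_le_trans)
        qed
        show "p \<in> verts C" if "C \<in> GS.sccs" "w \<in> verts C" "w = v \<or> v \<rightarrow> w" for C w
          using that sub uniq False by blast
      qed (use p graph_dist_adj_le in auto)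
    qed
    have near': "p \<in> verts C" if "C \<in> GS.sccs" "graph_dist_set G v (verts C) \<le> 1" for C
      using graph_dist_set_le_1D[OF that(2)] near[OF that(1)] by metis
    have dist_set: "graph_dist_set G v (verts C) = graph_dist G v p"
      if "C \<in> GS.sccs" "p \<in> verts C" for C
      unfolding graph_dist_set_def
    proof (rule antisym)
      show "(INF w\<in>verts C. graph_dist G v w) \<le> graph_dist G v p"
        using that(2) by (rule INF_lower)
      show "graph_dist G v p \<le> (INF w\<in>verts C. graph_dist G v w)"
        using sub[OF that(1)] strict by (intro INF_greatest) (metis order_refl less_imp_le subsetD)
    qed
    have "\<exists>!C. C \<in> GS.sccs \<and> p \<in> verts C"
    proof -
      have "GS.scc_of p \<in> GS.sccs_verts" "p \<in> GS.scc_of p"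
        using p(1) by (auto intro: GS.scc_of_in_sccs_verts GS.in_scc_of_self)
      then obtain C where "C \<in> GS.sccs" "p \<in> verts C"
        by (auto simp: GS.sccs_verts_conv)
      \<comment> \<open>Distinct component vertex sets are disjoint, and a component is determined
        by its vertex set.\<close>
      moreover have "C' = C" if "C' \<in> GS.sccs" "p \<in> verts C'" for C'
        using GS.sccs_verts_disjoint[of "verts C'" "verts C"] that calculation
          inj_onD[OF GS.inj_on_verts_sccs, of C' C]
        by (auto simp: GS.sccs_verts_conv)
      ultimately show ?thesis
        by blast
    qed
    then have "\<exists>!C. C \<in> GS.sccs \<and> graph_dist_set G v (verts C) \<le> 1"
      using near' dist_set p(2) by metis
    moreover have "\<exists>!w. w \<in> verts C \<and> graph_dist G v w = graph_dist_set G v (verts C)"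
      if "C \<in> GS.sccs" "graph_dist_set G v (verts C) \<le> 1" for C
      using near'[OF that] dist_set[OF that(1)] strict sub[OF that(1)]
      by (metis less_irrefl subsetD)
    ultimately show ?thesis
      by (intro conjI ballI impI)
  qed
  then show ?thesis
    using S by (simp add: PDDS_def one_ereal_def)
qed

end

section \<open>Isomorphism from a bijection of vertices\<close>

text \<open>\<open>digraph_iso\<close> also asks for a map on arcs. When arcs are pairs of vertices,
  \<open>map_prod f f\<close> serves, so a vertex bijection that preserves and reflects adjacency is
  enough.\<close>

lemma digraph_iso_pairI:
  fixes C :: "('a, 'a \<times> 'a) pre_digraph"
  assumes "wf_digraph C" "tail C = fst" "head C = snd"
    and bij: "bij_betw f (verts C) (pverts H)"
    and H: "parcs H \<subseteq> pverts H \<times> pverts H"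
    and arcs: "\<And>u v. u \<in> verts C \<Longrightarrow> v \<in> verts C \<Longrightarrow> (u, v) \<in> arcs C \<longleftrightarrow> (f u, f v) \<in> parcs H"
  shows "digraph_iso C (with_proj H)"
proof -
  interpret C: wf_digraph C by fact
  have ends: "u \<in> verts C \<and> v \<in> verts C" if "(u, v) \<in> arcs C" for u v
    using C.wellformed[OF that] assms(2,3) by simp
  have "map_prod f f ` arcs C = parcs H"
  proof
    show "map_prod f f ` arcs C \<subseteq> parcs H"
      using ends arcs by auto
    show "parcs H \<subseteq> map_prod f f ` arcs C"
    proof
      fix e assume e: "e \<in> parcs H"
      then obtain u v where "u \<in> verts C" "v \<in> verts C" "e = (f u, f v)"
        using H bij_betw_imp_surj_on[OF bij] by blast
      with e arcs show "e \<in> map_prod f f ` arcs C"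
        by (auto intro!: image_eqI[of _ _ "(u, v)"])
    qed
  qed
  moreover have "inj_on (map_prod f f) (arcs C)"
  proof (rule inj_on_subset)
    show "inj_on (map_prod f f) (verts C \<times> verts C)"
      using bij by (intro map_prod_inj_on) (auto simp: bij_betw_def)
    show "arcs C \<subseteq> verts C \<times> verts C"
      using ends by auto
  qed
  ultimately have "C.digraph_isomorphism
        \<lparr>iso_verts = f, iso_arcs = map_prod f f, iso_head = snd, iso_tail = fst\<rparr> \<and>
      with_proj H = app_iso \<lparr>iso_verts = f, iso_arcs = map_prod f f, iso_head = snd, iso_tail = fst\<rparr> C"
    using bij assms(1-3)
    by (auto simp: C.digraph_isomorphism_def app_iso_def with_proj_def bij_betw_def)
  then show ?thesis
    unfolding digraph_iso_def by blast
qed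

section \<open>The arrangement of cubes\<close>

text \<open>Either equation forces all three numbers into {-1, 0, 1}, where squares and absolute
  values agree. This trades Euclidean distance for a form suited to linear arithmetic.\<close>

lemma sum_squares_eq_1_iff:
  fixes a b c :: int
  shows "a\<^sup>2 + b\<^sup>2 + c\<^sup>2 = 1 \<longleftrightarrow> \<bar>a\<bar> + \<bar>b\<bar> + \<bar>c\<bar> = 1"
proof
  assume eq: "a\<^sup>2 + b\<^sup>2 + c\<^sup>2 = 1"
  then have "a\<^sup>2 \<le> 1" "b\<^sup>2 \<le> 1" "c\<^sup>2 \<le> 1"
    using zero_le_power2[of a] zero_le_power2[of b] zero_le_power2[of c] by linarith+
  then have "\<bar>a\<bar> \<le> 1" "\<bar>b\<bar> \<le> 1" "\<bar>c\<bar> \<le> 1"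
    by (simp_all add: abs_square_le_1)
  then have "a \<in> {-1, 0, 1}" "b \<in> {-1, 0, 1}" "c \<in> {-1, 0, 1}"
    by auto
  then show "\<bar>a\<bar> + \<bar>b\<bar> + \<bar>c\<bar> = 1"
    using eq by auto
next
  assume eq: "\<bar>a\<bar> + \<bar>b\<bar> + \<bar>c\<bar> = 1"
  then have "a \<in> {-1, 0, 1}" "b \<in> {-1, 0, 1}" "c \<in> {-1, 0, 1}"
    by auto
  then show "a\<^sup>2 + b\<^sup>2 + c\<^sup>2 = 1"
    using eq by auto
qed

lemma lattice3_arc_iff:
  "(x, y) \<in> parcs lattice3 \<longleftrightarrow> \<bar>x$1 - y$1\<bar> + \<bar>x$2 - y$2\<bar> + \<bar>x$3 - y$3\<bar> = 1"
proof -
  have "(x, y) \<in> parcs lattice3 \<longleftrightarrow>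
      real_of_int ((x$1 - y$1)\<^sup>2 + (x$2 - y$2)\<^sup>2 + (x$3 - y$3)\<^sup>2) = 1"
    by (simp add: lattice3_def dist_vec_def L2_set_def sum_3 dist_real_def)
  also have "\<dots> \<longleftrightarrow> (x$1 - y$1)\<^sup>2 + (x$2 - y$2)\<^sup>2 + (x$3 - y$3)\<^sup>2 = 1"
    by linarith
  finally show ?thesis
    by (simp only: sum_squares_eq_1_iff)
qed

lemma lattice3_arc_cases:
  assumes "(x, y) \<in> parcs lattice3"
  obtains "\<bar>x$1 - y$1\<bar> = 1" "x$2 = y$2" "x$3 = y$3"
    | "x$1 = y$1" "\<bar>x$2 - y$2\<bar> = 1" "x$3 = y$3"
    | "x$1 = y$1" "x$2 = y$2" "\<bar>x$3 - y$3\<bar> = 1"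
  using assms unfolding lattice3_arc_iff by linarith

section \<open>Parity arithmetic of the cubes\<close>

definition cube_set :: "(int ^ 3) set" where
  "cube_set = {v. (even (v$1 div 2) \<longleftrightarrow> even (v$2 div 2)) \<and> (even (v$2 div 2) \<longleftrightarrow> even (v$3 div 2))}"

text \<open>Any vertex of a cube may name it. Since \<open>div\<close> rounds downwards, the pairs
  {2k, 2k + 1} also tile the negative integers.\<close>

definition cube_of :: "int ^ 3 \<Rightarrow> (int ^ 3) set" where
  "cube_of u = {v. v$1 div 2 = u$1 div 2 \<and> v$2 div 2 = u$2 div 2 \<and> v$3 div 2 = u$3 div 2}"

text \<open>The unique neighbour of \<open>x\<close> in \<open>\<int>\<close> that is not in the same pair \<open>{2k, 2k + 1}\<close>.\<close>

definition outer :: "int \<Rightarrow> int" where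
  "outer x = (if even x then x - 1 else x + 1)"

lemma outer_dist: "\<bar>x - outer x\<bar> = 1"
  by (simp add: outer_def)

lemma even_outer_div_2: "even (outer x div 2) \<longleftrightarrow> odd (x div 2)"
  unfolding outer_def by presburger

lemma neighbour_eq_outer:
  fixes x y :: int
  assumes "\<bar>x - y\<bar> = 1" "even (y div 2) \<longleftrightarrow> odd (x div 2)"
  shows "y = outer x"
  using assms unfolding outer_def by presburger

text \<open>A unit step moves the pair index by at most one, so equal parity leaves only
  equality.\<close>

lemma neighbour_same_pair:
  fixes x y :: int
  assumes "\<bar>x - y\<bar> = 1" "even (x div 2) \<longleftrightarrow> even (y div 2)"
  shows "y div 2 = x div 2"
  using assms by presburger

text \<open>The two coordinates left fixed by the arc have the same indices at both ends. Membership
  in \<open>cube_set\<close> carries their parity over to the moving coordinate at both ends, whose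
  index therefore cannot change.\<close>

lemma cube_set_arc_same_cube:
  assumes "x \<in> cube_set" "y \<in> cube_set" "(x, y) \<in> parcs lattice3"
  shows "y \<in> cube_of x"
  using assms(3)
proof (cases rule: lattice3_arc_cases)
  case 1
  then have "even (x$1 div 2) \<longleftrightarrow> even (y$1 div 2)"
    using assms(1,2) unfolding cube_set_def mem_Collect_eq by metis
  with 1 have "y$1 div 2 = x$1 div 2"
    by (intro neighbour_same_pair)
  then show ?thesis
    using 1 by (simp add: cube_of_def)
next
  case 2
  then have "even (x$2 div 2) \<longleftrightarrow> even (y$2 div 2)"
    using assms(1,2) unfolding cube_set_def mem_Collect_eq by metis
  with 2 have "y$2 div 2 = x$2 div 2"
    by (intro neighbour_same_pair)
  then show ?thesis
    using 2 by (simp add: cube_of_def)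
next
  case 3
  then have "even (x$3 div 2) \<longleftrightarrow> even (y$3 div 2)"
    using assms(1,2) unfolding cube_set_def mem_Collect_eq by metis
  with 3 have "y$3 div 2 = x$3 div 2"
    by (intro neighbour_same_pair)
  then show ?thesis
    using 3 by (simp add: cube_of_def)
qed

lemma cube_set_unique_neighbour:
  assumes "v \<notin> cube_set"
  shows "\<exists>!w. w \<in> cube_set \<and> (v, w) \<in> parcs lattice3"
proof -
  let ?P = "\<lambda>i. even (v$i div 2)"
  \<comment> \<open>Of three parities that are not all equal, exactly one deviates from the other
    two.\<close>
  consider "?P 2 = ?P 3" "?P 1 \<noteq> ?P 2" | "?P 1 = ?P 3" "?P 2 \<noteq> ?P 1" | "?P 1 = ?P 2" "?P 3 \<noteq> ?P 1"
    using assms by (auto simp: cube_set_def)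
  then show ?thesis
  proof cases
    case 1
    show ?thesis
    proof (rule ex1I[of _ "vector [outer (v$1), v$2, v$3]"])
      fix w assume w: "w \<in> cube_set \<and> (v, w) \<in> parcs lattice3"
      then have "(v, w) \<in> parcs lattice3" by simp
      \<comment> \<open>A step in another direction leaves two disagreeing parities untouched. A
        step in this direction must flip the parity, which determines it as
        \<open>outer\<close>.\<close>
      then show "w = vector [outer (v$1), v$2, v$3]"
        by (cases rule: lattice3_arc_cases)
          (use w 1 neighbour_eq_outer in \<open>auto simp: cube_set_def vec_eq_iff forall_3\<close>)
    qed (use 1 in \<open>auto simp: cube_set_def lattice3_arc_iff outer_dist even_outer_div_2\<close>)
  next
    case 2
    show ?thesis
    proof (rule ex1I[of _ "vector [v$1, outer (v$2), v$3]"])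
      fix w assume w: "w \<in> cube_set \<and> (v, w) \<in> parcs lattice3"
      then have "(v, w) \<in> parcs lattice3" by simp
      then show "w = vector [v$1, outer (v$2), v$3]"
        by (cases rule: lattice3_arc_cases)
          (use w 2 neighbour_eq_outer in \<open>auto simp: cube_set_def vec_eq_iff forall_3\<close>)
    qed (use 2 in \<open>auto simp: cube_set_def lattice3_arc_iff outer_dist even_outer_div_2\<close>)
  next
    case 3
    show ?thesis
    proof (rule ex1I[of _ "vector [v$1, v$2, outer (v$3)]"])
      fix w assume w: "w \<in> cube_set \<and> (v, w) \<in> parcs lattice3"
      then have "(v, w) \<in> parcs lattice3" by simp
      then show "w = vector [v$1, v$2, outer (v$3)]"
        by (cases rule: lattice3_arc_cases)
          (use w 3 neighbour_eq_outer in \<open>auto simp: cube_set_def vec_eq_iff forall_3\<close>)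
    qed (use 3 in \<open>auto simp: cube_set_def lattice3_arc_iff outer_dist even_outer_div_2\<close>)
  qed
qed

section \<open>The components are the cubes\<close>

lemma same_pair_dist:
  fixes x y :: int
  assumes "x div 2 = y div 2"
  shows "x = y \<or> \<bar>x - y\<bar> = 1"
  using assms by presburger

lemma cube_subset_cube_set: "u \<in> cube_set \<Longrightarrow> cube_of u \<subseteq> cube_set"
  unfolding cube_set_def cube_of_def by (intro subsetI, unfold mem_Collect_eq, metis)

lemma wf_lattice3: "wf_digraph (with_proj lattice3)"
  by (simp add: wf_digraph_def lattice3_def)

lemma wf_lattice3_induce: "wf_digraph (with_proj lattice3 \<restriction> S)"
  by (rule wf_digraph.wellformed_induce_subgraph[OF wf_lattice3])

text \<open>The coordinates of \<open>u\<close> are replaced by those of \<open>v\<close> one at a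
  time, through \<open>?a\<close> and \<open>?b\<close>. All these points share the pair indices of
  \<open>u\<close>, so the walk stays in its cube.\<close>

lemma cube_reachable:
  assumes "u \<in> cube_set" "v \<in> cube_of u"
  shows "u \<rightarrow>\<^sup>*\<^bsub>with_proj lattice3 \<restriction> cube_set\<^esub> v"
proof -
  interpret GS: wf_digraph "with_proj lattice3 \<restriction> cube_set"
    by (rule wf_lattice3_induce)
  have step: "x \<rightarrow>\<^sup>*\<^bsub>with_proj lattice3 \<restriction> cube_set\<^esub> y"
    if "x \<in> cube_of u" "y \<in> cube_of u" "x = y \<or> (x, y) \<in> parcs lattice3" for x y
  proof -
    have "x \<in> cube_set" "y \<in> cube_set"
      using that cube_subset_cube_set[OF assms(1)] by auto
    then show ?thesis
      using that(3) by (auto simp: arcs_ends_conv intro: GS.reachable_adjI)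
  qed
  let ?a = "vector [v$1, u$2, u$3] :: int ^ 3" and ?b = "vector [v$1, v$2, u$3] :: int ^ 3"
  have v: "u$1 div 2 = v$1 div 2" "u$2 div 2 = v$2 div 2" "u$3 div 2 = v$3 div 2"
    using assms(2) by (auto simp: cube_of_def)
  have in_cube: "u \<in> cube_of u" "?a \<in> cube_of u" "?b \<in> cube_of u"
    using v by (auto simp: cube_of_def)
  have "u = ?a \<or> (u, ?a) \<in> parcs lattice3" "?a = ?b \<or> (?a, ?b) \<in> parcs lattice3"
    "?b = v \<or> (?b, v) \<in> parcs lattice3"
    using v[THEN same_pair_dist] by (auto simp: lattice3_arc_iff vec_eq_iff forall_3)
  then show ?thesis
    using step in_cube assms(2) by (meson GS.reachable_trans)
qed

lemma cube_of_self: "u \<in> cube_of u"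
  by (simp add: cube_of_def)

lemma cube_of_sym: "v \<in> cube_of u \<Longrightarrow> u \<in> cube_of v"
  by (simp add: cube_of_def)

lemma cube_of_trans: "v \<in> cube_of u \<Longrightarrow> w \<in> cube_of v \<Longrightarrow> w \<in> cube_of u"
  by (simp add: cube_of_def)

text \<open>Arcs inside \<open>cube_set\<close> never leave a cube, and within a cube all vertices
  reach one another.\<close>

lemma scc_of_cube_set:
  assumes "u \<in> cube_set"
  shows "pre_digraph.scc_of (with_proj lattice3 \<restriction> cube_set) u = cube_of u"
proof -
  interpret GS: wf_digraph "with_proj lattice3 \<restriction> cube_set"
    by (rule wf_lattice3_induce)
  have "v \<in> cube_of u" if "u \<rightarrow>\<^sup>*\<^bsub>with_proj lattice3 \<restriction> cube_set\<^esub> v" for v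
    using that
  proof (induction rule: GS.reachable_induct)
    case base
    show ?case by (rule cube_of_self)
  next
    case (step x y)
    then have "x \<in> cube_set" "y \<in> cube_set" "(x, y) \<in> parcs lattice3"
      by (auto simp: arcs_ends_conv)
    then show ?case
      using step.IH cube_set_arc_same_cube cube_of_trans by blast
  qed
  moreover have "v \<rightarrow>\<^sup>*\<^bsub>with_proj lattice3 \<restriction> cube_set\<^esub> u" if "v \<in> cube_of u" for v
    using that cube_subset_cube_set[OF assms] cube_of_sym cube_reachable by blast
  ultimately show ?thesis
    using cube_reachable[OF assms] by (auto simp: GS.scc_of_def)
qed

section \<open>Each cube is a copy of \<open>hypercube3\<close>\<close>

lemma hypercube3_verts: "pverts hypercube3 = {..<2} \<times> {..<2} \<times> {..<2}"
  by (simp add: hypercube3_def cartesian_product_def path_graph_def)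

text \<open>Checked on all 64 pairs of bit triples; the right-hand side matches the description of
  arcs in \<open>lattice3_arc_iff\<close>.\<close>

lemma hypercube3_arc_iff:
  assumes "a < 2" "b < 2" "c < 2" "a' < 2" "b' < 2" "c' < 2"
  shows "((a, b, c), (a', b', c')) \<in> parcs hypercube3 \<longleftrightarrow>
    \<bar>int a - int a'\<bar> + \<bar>int b - int b'\<bar> + \<bar>int c - int c'\<bar> = 1"
  using assms[THEN less_2_cases]
  by (elim disjE) (simp_all add: hypercube3_def cartesian_product_def path_graph_def)

lemma bij_betw_cube_hypercube3:
  "bij_betw (\<lambda>v. (nat (v$1 mod 2), nat (v$2 mod 2), nat (v$3 mod 2))) (cube_of u) (pverts hypercube3)"
  (is "bij_betw ?f _ _")
proof -
  \<comment> \<open>The inverse map adds the bits to the lowest corner of the cube.\<close>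
  define g :: "nat \<times> nat \<times> nat \<Rightarrow> int ^ 3" where "g = (\<lambda>(a, b, c).
    vector [2 * (u$1 div 2) + int a, 2 * (u$2 div 2) + int b, 2 * (u$3 div 2) + int c])"
  have pair: "2 * (k div 2) + x mod 2 = x" if "x div 2 = k div 2" for x k :: int
    using that[symmetric] by simp
  have digits: "(2 * k + int a) div 2 = k" "(2 * k + int a) mod 2 = int a" if "a < 2" for k a
    using that by auto
  have nat_mod: "nat (x mod 2) < 2" for x :: int
    by (simp add: nat_less_iff)
  show ?thesis
  proof (rule bij_betw_byWitness[where f' = g])
    show "\<forall>v\<in>cube_of u. g (?f v) = v"
      by (simp add: cube_of_def g_def vec_eq_iff forall_3 pair)
    show "\<forall>t\<in>pverts hypercube3. ?f (g t) = t"
      by (simp add: hypercube3_verts g_def digits split_beta)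
    show "?f ` cube_of u \<subseteq> pverts hypercube3"
      by (auto simp: hypercube3_verts nat_mod)
    show "g ` pverts hypercube3 \<subseteq> cube_of u"
      by (auto simp: hypercube3_verts g_def cube_of_def digits)
  qed
qed

text \<open>The nested restriction is the form in which a component of the graph induced by
  \<open>S\<close> arises.\<close>

lemma cube_iso_hypercube3:
  assumes "cube_of u \<subseteq> S"
  shows "digraph_iso ((with_proj lattice3 \<restriction> S) \<restriction> cube_of u) (with_proj hypercube3)"
proof (rule digraph_iso_pairI)
  show "wf_digraph ((with_proj lattice3 \<restriction> S) \<restriction> cube_of u)"
    by (rule wf_digraph.wellformed_induce_subgraph[OF wf_lattice3_induce])
  show "bij_betw (\<lambda>v. (nat (v$1 mod 2), nat (v$2 mod 2), nat (v$3 mod 2)))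
      (verts ((with_proj lattice3 \<restriction> S) \<restriction> cube_of u)) (pverts hypercube3)"
    using bij_betw_cube_hypercube3 by simp
  show "parcs hypercube3 \<subseteq> pverts hypercube3 \<times> pverts hypercube3"
    by (auto simp: hypercube3_def cartesian_product_def path_graph_def)
next
  fix x y assume "x \<in> verts ((with_proj lattice3 \<restriction> S) \<restriction> cube_of u)"
    and "y \<in> verts ((with_proj lattice3 \<restriction> S) \<restriction> cube_of u)"
  then have xy: "x \<in> cube_of u" "y \<in> cube_of u" by simp_all
  \<comment> \<open>Reduction mod 2 is a translation on each pair, so it keeps coordinate
    differences and hence adjacency.\<close>
  have diff: "x$i mod 2 - y$i mod 2 = x$i - y$i" if "x$i div 2 = y$i div 2" for i
    using that by presburger
  have "(x, y) \<in> arcs ((with_proj lattice3 \<restriction> S) \<restriction> cube_of u) \<longleftrightarrow> (x, y) \<in> parcs lattice3"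
    using xy assms by auto
  also have "\<dots> \<longleftrightarrow> ((nat (x$1 mod 2), nat (x$2 mod 2), nat (x$3 mod 2)),
      (nat (y$1 mod 2), nat (y$2 mod 2), nat (y$3 mod 2))) \<in> parcs hypercube3"
    using xy by (subst hypercube3_arc_iff)
      (auto simp: nat_less_iff lattice3_arc_iff diff cube_of_def)
  finally show "(x, y) \<in> arcs ((with_proj lattice3 \<restriction> S) \<restriction> cube_of u) \<longleftrightarrow>
      ((nat (x$1 mod 2), nat (x$2 mod 2), nat (x$3 mod 2)),
       (nat (y$1 mod 2), nat (y$2 mod 2), nat (y$3 mod 2))) \<in> parcs hypercube3" .
qed simp_all

theorem theorem4:
  shows "\<exists>S. PDDS_of (with_proj lattice3) 1 (with_proj hypercube3) S"
proof
  interpret GS: wf_digraph "with_proj lattice3 \<restriction> cube_set"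
    by (rule wf_lattice3_induce)
  have "PDDS (with_proj lattice3) 1 cube_set"
  proof (rule wf_digraph.PDDS_1I[OF wf_lattice3])
    show "symmetric (with_proj lattice3)"
      using lattice3_bidirected
      by (simp add: pair_bidirected_digraph_def pair_sym_digraph_def pair_sym_digraph_axioms_def)
    show "\<exists>!w. w \<in> cube_set \<and> v \<rightarrow>\<^bsub>with_proj lattice3\<^esub> w" if "v \<notin> cube_set" for v
      using cube_set_unique_neighbour[OF that] by (simp add: arcs_ends_conv)
  qed (simp add: lattice3_def)
  \<comment> \<open>A component is induced by \<open>scc_of u\<close> for some \<open>u\<close> in
    \<open>cube_set\<close>, that is, by the cube of \<open>u\<close>.\<close>
  moreover have "digraph_iso C (with_proj hypercube3)" if "C \<in> GS.sccs" for C
    using that scc_of_cube_set cube_iso_hypercube3 cube_subset_cube_set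
    by (auto simp: GS.sccs_conv_sccs_verts GS.sccs_verts_conv_scc_of)
  ultimately show "PDDS_of (with_proj lattice3) 1 (with_proj hypercube3) cube_set"
    by (simp add: PDDS_of_def)
qed

end
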